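(* Let $(x^k)$ be generated by iPiano (see context) and set $z^k:=(x^k,x^{k-1})$. Let $H_\kappa(x,y)=h(x)+\kappa|x-y|^2$ with $\kappa>0$ as in the context, and let $z^*=(x^*,x^* )$ be the limit point specified in (H3), i.e. $z^{k_j}\to z^*$ and $H_\kappa(z^{k_j})\to H_\kappa(z^* )$ along some subsequence. If $H_\kappa$ has the KL property at $z^*$ with KL-exponent $\theta$, then the following rates of convergence hold: 1. If $\theta=1$, then $x^k$ converges to $x^*$ in a finite number of iterations. 2. If $\frac12\le\theta<1$, then $h(x^k)\to h(x^* )$ and $x^k\to x^*$ linearly. 3. If $0<\theta<\frac12$, then $h(x^k)-h(x^* )\in O\big(k^{\frac1{2\theta-1}}\big)$ and $|x^k-x^*|\in O\big(k^{\frac{\theta}{2\theta-1}}\big)$.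
   Context: $|\cdot|$ is the Euclidean norm, $\overline{\mathbb R}=\mathbb R\cup\{+\infty\}$, $B_\varepsilon(\bar x)=\{x: |x-\bar x|\le\varepsilon\}$. Problem: minimize $h(x)=f(x)+g(x)$ over $x\in\mathbb R^N$, $h\colon\mathbb R^N\to\overline{\mathbb R}$ proper lsc, where either $U=\mathbb R^N$, or $U=B_{r'}(\hat x)$ for a local minimizer $\hat x$ of $h$ and some $r'>0$. Assumption: $f\colon U\to\mathbb R$ is $C^1$ (possibly non-convex) with $L$-Lipschitz continuous gradient on $\operatorname{dom}g\cap U$, $L>0$; $g\colon U\to\overline{\mathbb R}$ is proper, lsc, possibly non-smooth and non-convex, prox-bounded ($\inf_w g(w)+\frac1{2\lambda}|w-x|^2>-\infty$ for some $\lambda>0$ and some $x$), and simple (informally: its proximal map can be evaluated to global optimality); $h$ restricted to $U$ is bounded from below and coercive ($|x|\to\infty$ with $x\in U$ implies $h(x)\to\infty$). iPiano: choose $x^0\in\operatorname{dom}h\cap U$, set $x^{-1}=x^0$, and for $k\ge0$ $$y^k=x^k+\beta(x^k-x^{k-1}),\qquad x^{k+1}\in\arg\min_{x\in\mathbb R^N}\ g(x)+\langle\nabla f(x^k),x-x^k\rangle+\tfrac1{2\alpha}|x-y^k|^2 .$$ Admissible constant parameters: - $g$ convex (including $g\equiv0$, the Heavy-ball method): $\beta\in[0,1)$, $\alpha\in(0,2(1-\beta)/L)$; - $g$ non-convex: $\beta\in[0,\frac12)$, $\alpha\in(0,(1-2\beta)/L)$; - $g$ $m$-semi-convex, $m<L$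 (i.e. $m\in\mathbb R$ is the largest value such that $g-\frac m2|\cdot|^2$ is convex): $\beta\in[0,1)$, $\alpha\in(0,2(1-\beta)/(L-m))$; - special cases: $f\equiv0$, $g$ convex: $\beta=0$, $\alpha>0$; $g$ convex, $\beta=0$, $\alpha\in(0,2/L)$; $g$ non-convex, $\beta=0$, $\alpha\in(0,1/L)$. The constant $\kappa>0$, together with constants $a,b>0$, is such that the sequence $(z^k)$ generated by iPiano satisfies the following for $\mathcal F=H_\kappa$ (existence of such constants is known): (H1) for each $k\ge0$, $\mathcal F(z^{k+1})+a|x^k-x^{k-1}|^2\le\mathcal F(z^k)$; (H2) for each $k\ge0$ there is $w^{k+1}\in\partial\mathcal F(z^{k+1})$ with $|w^{k+1}|\le\frac b2(|x^k-x^{k-1}|+|x^{k+1}-x^k|)$; (H3) there is a subsequence with $z^{k_j}\to\tilde z$ and $\mathcal F(z^{k_j})\to\mathcal F(\tilde z)$. Here $\partial$ is the limiting subdifferential (limits $v$ of Fréchet subgradients $v^n\in\widehat\partial f(x^n)$ with $x^n\to\bar x$, $f(x^n)\to f(\bar x)$). KL property: $f\colon\mathbb R^n\to\overline{\mathbb R}$ has the KL property at $\bar x\in\operatorname{dom}\partial f$ if there exist $\eta\in(0,\infty]$, a neighborhood $V$ of $\bar x$ and a continuous concave $\varphi\colon[0,\eta)\to\mathbb R_+$ with $\varphi(0)=0$, $\varphi\in C^1((0,\eta))$, $\varphi'>0$ on $(0,\eta)$, such that $\varphi'(f(x)-f(\bar x))\inf_{v\in\partial f(x)}|v|\ge1$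 for all $x\in V$ with $f(\bar x)<f(x)<f(\bar x)+\eta$ ($\inf\emptyset=+\infty$). It has KL-exponent $\theta\in(0,1]$ there if $\varphi$ can be taken of the form $\varphi(s)=\frac c\theta s^\theta$ with a constant $c>0$. *)

theory Defs
  imports "HOL-Analysis.Analysis" "HOL-Library.Landau_Symbols"
begin

subsection \<open>Extended-valued functions\<close>

text \<open>Functions into the reals with plus infinity are modelled by \<open>ereal\<close>-valued functions;
  \<open>proper_on\<close> excludes the value minus infinity.\<close>

definition proper_on :: "'a set \<Rightarrow> ('a \<Rightarrow> ereal) \<Rightarrow> bool" where
  "proper_on U g \<longleftrightarrow> (\<forall>x\<in>U. g x \<noteq> -\<infinity>) \<and> (\<exists>x\<in>U. g x < \<infinity>)"

definition edom :: "('a \<Rightarrow> ereal) \<Rightarrow> 'a set" where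
  "edom g = {x. g x < \<infinity>}"

definition lsc_on :: "'a::topological_space set \<Rightarrow> ('a \<Rightarrow> ereal) \<Rightarrow> bool" where
  "lsc_on U g \<longleftrightarrow> (\<forall>x\<in>U. g x \<le> Liminf (at x within U) g)"

text \<open>Used only for convex \<open>U\<close> and for \<open>g\<close> never equal to minus infinity on \<open>U\<close>.\<close>

definition ext_convex_on :: "'a::real_vector set \<Rightarrow> ('a \<Rightarrow> ereal) \<Rightarrow> bool" where
  "ext_convex_on U g \<longleftrightarrow> (\<forall>x\<in>U. \<forall>y\<in>U. \<forall>t::real. 0 < t \<and> t < 1 \<longrightarrow>
     g ((1 - t) *\<^sub>R x + t *\<^sub>R y) \<le> ereal (1 - t) * g x + ereal t * g y)"

definition semi_convex_on :: "'a::real_normed_vector set \<Rightarrow> real \<Rightarrow> ('a \<Rightarrow> ereal) \<Rightarrow> bool" where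
  "semi_convex_on U m g \<longleftrightarrow>
     ext_convex_on U (\<lambda>x. g x - ereal (m / 2 * (norm x)\<^sup>2)) \<and>
     (\<forall>m'. ext_convex_on U (\<lambda>x. g x - ereal (m' / 2 * (norm x)\<^sup>2)) \<longrightarrow> m' \<le> m)"

definition prox_bounded_on :: "'a::real_normed_vector set \<Rightarrow> ('a \<Rightarrow> ereal) \<Rightarrow> bool" where
  "prox_bounded_on U g \<longleftrightarrow> (\<exists>r x. 0 < (r::real) \<and>
     (INF w\<in>U. g w + ereal (1 / (2 * r) * (norm (w - x))\<^sup>2)) > -\<infinity>)"

definition coercive_on :: "'a::real_normed_vector set \<Rightarrow> ('a \<Rightarrow> ereal) \<Rightarrow> bool" where
  "coercive_on U h \<longleftrightarrow> (h \<longlongrightarrow> \<infinity>) (inf at_infinity (principal U))"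

definition bounded_below_on :: "'a set \<Rightarrow> ('a \<Rightarrow> ereal) \<Rightarrow> bool" where
  "bounded_below_on U h \<longleftrightarrow> (\<exists>c::real. \<forall>x\<in>U. ereal c \<le> h x)"

definition local_minimizer :: "('a::metric_space \<Rightarrow> ereal) \<Rightarrow> 'a \<Rightarrow> bool" where
  "local_minimizer h x \<longleftrightarrow> h x < \<infinity> \<and> (\<exists>e>0. \<forall>y\<in>ball x e. h x \<le> h y)"


subsection \<open>Subdifferentials and the Kurdyka--Lojasiewicz property\<close>

definition frechet_subdiff :: "('a::euclidean_space \<Rightarrow> ereal) \<Rightarrow> 'a \<Rightarrow> 'a set" where
  "frechet_subdiff f x = {v. \<bar>f x\<bar> \<noteq> \<infinity> \<and>
     0 \<le> Liminf (at x) (\<lambda>y. (f y - f x - ereal (v \<bullet> (y - x))) / ereal (norm (y - x)))}"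

definition limiting_subdiff :: "('a::euclidean_space \<Rightarrow> ereal) \<Rightarrow> 'a \<Rightarrow> 'a set" where
  "limiting_subdiff f x = {v. \<bar>f x\<bar> \<noteq> \<infinity> \<and>
     (\<exists>xs vs. xs \<longlonglongrightarrow> x \<and> (\<lambda>n. f (xs n)) \<longlonglongrightarrow> f x \<and>
        (\<forall>n. vs n \<in> frechet_subdiff f (xs n)) \<and> vs \<longlonglongrightarrow> v)}"

definition desingularizing :: "ereal \<Rightarrow> (real \<Rightarrow> real) \<Rightarrow> bool" where
  "desingularizing \<eta> \<phi> \<longleftrightarrow>
     continuous_on {s. 0 \<le> s \<and> ereal s < \<eta>} \<phi> \<and>
     concave_on {s. 0 \<le> s \<and> ereal s < \<eta>} \<phi> \<and>
     (\<forall>s. 0 \<le> s \<and> ereal s < \<eta> \<longrightarrow> 0 \<le> \<phi> s) \<and>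
     \<phi> 0 = 0 \<and>
     (\<forall>s. 0 < s \<and> ereal s < \<eta> \<longrightarrow> \<phi> differentiable (at s) \<and> 0 < deriv \<phi> s) \<and>
     continuous_on {s. 0 < s \<and> ereal s < \<eta>} (deriv \<phi>)"

text \<open>The KL property of \<open>f\<close> at \<open>xb\<close> with a prescribed \<open>\<eta>\<close> and desingularizing function \<open>\<phi>\<close>.
  The infimum is taken in \<open>ereal\<close>, hence is infinite for an empty subdifferential.\<close>

definition KL_property_with ::
    "('a::euclidean_space \<Rightarrow> ereal) \<Rightarrow> 'a \<Rightarrow> ereal \<Rightarrow> (real \<Rightarrow> real) \<Rightarrow> bool" where
  "KL_property_with f xb \<eta> \<phi> \<longleftrightarrow>
     limiting_subdiff f xb \<noteq> {} \<and> 0 < \<eta> \<and> desingularizing \<eta> \<phi> \<and>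
     (\<exists>V. open V \<and> xb \<in> V \<and>
       (\<forall>x\<in>V. f xb < f x \<and> f x < f xb + \<eta> \<longrightarrow>
          1 \<le> ereal (deriv \<phi> (real_of_ereal (f x - f xb))) *
              (INF v\<in>limiting_subdiff f x. ereal (norm v))))"

definition KL_exponent :: "('a::euclidean_space \<Rightarrow> ereal) \<Rightarrow> 'a \<Rightarrow> real \<Rightarrow> bool" where
  "KL_exponent f xb \<theta> \<longleftrightarrow> 0 < \<theta> \<and> \<theta> \<le> 1 \<and>
     (\<exists>\<eta> c. 0 < c \<and> KL_property_with f xb \<eta> (\<lambda>s. c / \<theta> * s powr \<theta>))"


subsection \<open>iPiano\<close>

text \<open>Only the values of \<open>f\<close>, \<open>df\<close> (the gradient of \<open>f\<close>) and \<open>g\<close> on \<open>U\<close> matter. The function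
  \<open>h\<close> lives on the whole space and is the sum of \<open>f\<close> and \<open>g\<close> on \<open>U\<close>.\<close>

definition ipiano_problem ::
    "'a::euclidean_space set \<Rightarrow> real \<Rightarrow> ('a \<Rightarrow> real) \<Rightarrow> ('a \<Rightarrow> 'a) \<Rightarrow> ('a \<Rightarrow> ereal) \<Rightarrow>
     ('a \<Rightarrow> ereal) \<Rightarrow> bool" where
  "ipiano_problem U L f df g h \<longleftrightarrow>
     proper_on UNIV h \<and> lsc_on UNIV h \<and>
     (U = UNIV \<or> (\<exists>xh r. local_minimizer h xh \<and> 0 < r \<and> U = cball xh r)) \<and>
     (\<forall>x\<in>U. h x = ereal (f x) + g x) \<and>
     (\<forall>x\<in>U. (f has_derivative (\<lambda>v. df x \<bullet> v)) (at x within U)) \<and> continuous_on U df \<and>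
     0 < L \<and> L-lipschitz_on (edom g \<inter> U) df \<and>
     proper_on U g \<and> lsc_on U g \<and> prox_bounded_on U g \<and>
     bounded_below_on U h \<and> coercive_on U h"

definition ipiano_params ::
    "'a::euclidean_space set \<Rightarrow> real \<Rightarrow> ('a \<Rightarrow> real) \<Rightarrow> ('a \<Rightarrow> ereal) \<Rightarrow> real \<Rightarrow> real \<Rightarrow> bool" where
  "ipiano_params U L f g \<alpha> \<beta> \<longleftrightarrow>
     (ext_convex_on U g \<and> 0 \<le> \<beta> \<and> \<beta> < 1 \<and> 0 < \<alpha> \<and> \<alpha> < 2 * (1 - \<beta>) / L) \<or>
     (\<not> ext_convex_on U g \<and> 0 \<le> \<beta> \<and> \<beta> < 1 / 2 \<and> 0 < \<alpha> \<and> \<alpha> < (1 - 2 * \<beta>) / L) \<or>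
     (\<exists>m<L. semi_convex_on U m g \<and>
        0 \<le> \<beta> \<and> \<beta> < 1 \<and> 0 < \<alpha> \<and> \<alpha> < 2 * (1 - \<beta>) / (L - m)) \<or>
     ((\<forall>x\<in>U. f x = 0) \<and> ext_convex_on U g \<and> \<beta> = 0 \<and> 0 < \<alpha>) \<or>
     (ext_convex_on U g \<and> \<beta> = 0 \<and> 0 < \<alpha> \<and> \<alpha> < 2 / L) \<or>
     (\<not> ext_convex_on U g \<and> \<beta> = 0 \<and> 0 < \<alpha> \<and> \<alpha> < 1 / L)"

text \<open>The convention that the iterate with index \<open>-1\<close> equals \<open>x 0\<close> is encoded by truncated
  subtraction: \<open>x (k - 1)\<close> is \<open>x 0\<close> for \<open>k = 0\<close>. As the minimization is over the whole space,
  \<open>g\<close> is extended by plus infinity outside \<open>U\<close>.\<close>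

definition ipiano_seq ::
    "'a::euclidean_space set \<Rightarrow> ('a \<Rightarrow> 'a) \<Rightarrow> ('a \<Rightarrow> ereal) \<Rightarrow> ('a \<Rightarrow> ereal) \<Rightarrow> real \<Rightarrow> real \<Rightarrow>
     (nat \<Rightarrow> 'a) \<Rightarrow> bool" where
  "ipiano_seq U df g h \<alpha> \<beta> x \<longleftrightarrow>
     x 0 \<in> edom h \<inter> U \<and>
     (\<forall>k. let y = x k + \<beta> *\<^sub>R (x k - x (k - 1)) in
        is_arg_min
          (\<lambda>u. (if u \<in> U then g u else \<infinity>) +
               ereal (df (x k) \<bullet> (u - x k) + 1 / (2 * \<alpha>) * (norm (u - y))\<^sup>2))
          (\<lambda>u. u \<in> UNIV) (x (Suc k)))"

definition zseq :: "(nat \<Rightarrow> 'a) \<Rightarrow> nat \<Rightarrow> 'a \<times> 'a" where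
  "zseq x k = (x k, x (k - 1))"

definition Hfun :: "('a::euclidean_space \<Rightarrow> ereal) \<Rightarrow> real \<Rightarrow> 'a \<times> 'a \<Rightarrow> ereal" where
  "Hfun h \<kappa> = (\<lambda>(x, y). h x + ereal (\<kappa> * (norm (x - y))\<^sup>2))"

definition cond_H1 :: "('a::euclidean_space \<times> 'a \<Rightarrow> ereal) \<Rightarrow> real \<Rightarrow> (nat \<Rightarrow> 'a) \<Rightarrow> bool" where
  "cond_H1 F a x \<longleftrightarrow>
     (\<forall>k. F (zseq x (Suc k)) + ereal (a * (norm (x k - x (k - 1)))\<^sup>2) \<le> F (zseq x k))"

definition cond_H2 :: "('a::euclidean_space \<times> 'a \<Rightarrow> ereal) \<Rightarrow> real \<Rightarrow> (nat \<Rightarrow> 'a) \<Rightarrow> bool" where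
  "cond_H2 F b x \<longleftrightarrow>
     (\<forall>k. \<exists>w\<in>limiting_subdiff F (zseq x (Suc k)).
        norm w \<le> b / 2 * (norm (x k - x (k - 1)) + norm (x (Suc k) - x k)))"

definition cond_H3 ::
    "('a::euclidean_space \<times> 'a \<Rightarrow> ereal) \<Rightarrow> (nat \<Rightarrow> 'a) \<Rightarrow> 'a \<times> 'a \<Rightarrow> bool" where
  "cond_H3 F x zt \<longleftrightarrow>
     (\<exists>r::nat \<Rightarrow> nat. strict_mono r \<and> (\<lambda>j. zseq x (r j)) \<longlonglongrightarrow> zt \<and>
        (\<lambda>j. F (zseq x (r j))) \<longlonglongrightarrow> F zt)"


text \<open>R-linear convergence, as a geometric bound on the error sequence \<open>e\<close>. Applied to
  \<open>\<bar>h (x k) - h xs\<bar>\<close> the bound includes finiteness of both values, since \<open>\<infinity> - \<infinity> = \<infinity>\<close> in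
  \<open>ereal\<close>.\<close>

definition linear_rate :: "(nat \<Rightarrow> ereal) \<Rightarrow> bool" where
  "linear_rate e \<longleftrightarrow>
     (\<exists>C q. 0 \<le> C \<and> 0 \<le> q \<and> q < 1 \<and> (\<forall>k. e k \<le> ereal (C * q ^ k)))"

end

theory Submission
  imports Defs
begin

text \<open>Let \<open>d k\<close> be the length of the step ending in \<open>x k\<close> and \<open>r k\<close> the gap between \<open>H\<close> at
  \<open>z k\<close> and its limit. Near the limit point the KL inequality and (H2) give
  \<open>r k powr (1 - \<theta>) \<le> M (d (k - 1) + d k)\<close>, while (H1) gives \<open>a (d k)\<^sup>2 \<le> r k - r (k + 1)\<close>.
  By concavity of \<open>s powr \<theta>\<close> these combine to \<open>d (k + 1) \<le> P k - P (k + 1)\<close> for a potential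
  \<open>P k\<close> of order \<open>r k powr \<theta> + sqrt (r k)\<close>. Hence the iterates stay near the limit point and
  their distance to it is at most \<open>P k\<close>. Squaring the first inequality and
  inserting the second gives \<open>r (k + 2) powr (2 - 2 * \<theta>) \<le> B (r k - r (k + 2))\<close>, which determines
  the rate of \<open>r\<close>.\<close>

section \<open>Decay of real sequences under two-step recursions\<close>

text \<open>Solving the recursion for the later term gives a contraction by
  \<open>B / (1 + B)\<close> over two steps, so the rate per step is its square root
  \<open>q\<close>.\<close>

lemma linear_decay_of_two_step_contraction:
  fixes r :: "nat \<Rightarrow> real"
  assumes B: "0 < B" and pos: "\<And>k. 0 \<le> r k" and mono: "\<And>k. r (Suc k) \<le> r k"
    and rec: "\<And>k. N \<le> k \<Longrightarrow> r (Suc (Suc k)) \<le> B * (r k - r (Suc (Suc k)))"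
  shows "\<exists>C q. 0 \<le> C \<and> 0 < q \<and> q < 1 \<and> (\<forall>k\<ge>N. r k \<le> C * q ^ k)"
proof -
  define q where "q = sqrt (B / (1 + B))"
  have q: "0 < q" "q < 1" and q2: "q * q = B / (1 + B)"
    using B by (auto simp: q_def)
  have contr: "r (Suc (Suc k)) \<le> q * q * r k" if "N \<le> k" for k
    using rec[OF that] B by (simp add: q2 field_simps)
  have "r (N + j) * q \<le> r N * q ^ j \<and> r (N + Suc j) * q \<le> r N * q ^ Suc j" for j
  proof (induction j)
    case 0
    show ?case using q pos[of N] mono[of N] by (simp add: mult_left_le)
  next
    case (Suc j)
    have "r (N + Suc (Suc j)) * q \<le> q * q * r (N + j) * q"
      using contr[of "N + j"] q by (intro mult_right_mono) auto
    also have "\<dots> = q * q * (r (N + j) * q)" by simp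
    also have "\<dots> \<le> q * q * (r N * q ^ j)"
      using Suc q by (intro mult_left_mono) auto
    finally show ?case using Suc by (simp add: algebra_simps)
  qed
  then have key: "r (N + j) * q \<le> r N * q ^ j" for j by blast
  have "r k \<le> r N / (q * q ^ N) * q ^ k" if k: "N \<le> k" for k
  proof -
    have "q ^ k = q ^ N * q ^ (k - N)"
      using k by (simp flip: power_add)
    then show ?thesis using key[of "k - N"] k q by (simp add: field_simps)
  qed
  then show ?thesis
    using q pos[of N] by (intro exI[of _ "r N / (q * q ^ N)"] exI[of _ q]) auto
qed

text \<open>The recursion is a discrete form of \<open>s' = - s powr (1 + p) / B\<close>, along
  which \<open>s powr (- p)\<close> grows at constant speed. If \<open>s \<le> 2 * t\<close>, the
  mean value theorem applies and the intermediate point is comparable to \<open>t\<close>, where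
  \<open>rec\<close> gives the bound. If \<open>s > 2 * t\<close>, the drop alone multiplies the
  negative power by at least \<open>2 powr p\<close>.\<close>

lemma powr_neg_increment:
  fixes s t p B S :: real
  assumes t: "0 < t" "t \<le> s" and S: "s \<le> S" and p: "0 < p" and B: "0 < B"
    and rec: "t powr (1 + p) \<le> B * (s - t)"
  shows "min (p * 2 powr (- (1 + p)) / B) ((2 powr p - 1) * S powr (- p))
    \<le> t powr (- p) - s powr (- p)"
proof (cases "s \<le> 2 * t")
  case True
  have "s \<noteq> t" using rec t by auto
  with t have lt: "t < s" by auto
  have "\<exists>z. t < z \<and> z < s \<and>
      s powr (- p) - t powr (- p) = (s - t) * ((- p) * z powr (- p - 1))"
    using t lt by (intro MVT2) (auto intro!: DERIV_powr derivative_eq_intros)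
  then obtain z where z: "t < z" "z < s"
    "s powr (- p) - t powr (- p) = (s - t) * ((- p) * z powr (- p - 1))" by blast
  have "2 powr (- (1 + p)) * t powr (- (1 + p)) = (2 * t) powr (- (1 + p))"
    using t by (simp add: powr_mult)
  also have "\<dots> \<le> z powr (- (1 + p))"
    using z t p True by (intro powr_mono2') auto
  finally have 1: "2 powr (- (1 + p)) * t powr (- (1 + p)) \<le> z powr (- (1 + p))" .
  have "1 \<le> B * (s - t) * t powr (- (1 + p))"
  proof -
    have "1 = t powr (1 + p) * t powr (- (1 + p))" using t by (simp flip: powr_add)
    also have "\<dots> \<le> B * (s - t) * t powr (- (1 + p))"
      using rec by (intro mult_right_mono) auto
    finally show ?thesis .
  qed
  then have "p * 2 powr (- (1 + p)) / B * 1
      \<le> p * 2 powr (- (1 + p)) / B * (B * (s - t) * t powr (- (1 + p)))"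
    using p B by (intro mult_left_mono) auto
  also have "\<dots> = p * (s - t) * (2 powr (- (1 + p)) * t powr (- (1 + p)))"
    using B by simp
  also have "\<dots> \<le> p * (s - t) * z powr (- (1 + p))"
    using p lt 1 by (intro mult_left_mono) auto
  also have "\<dots> = t powr (- p) - s powr (- p)"
  proof -
    have e: "- p - 1 = - (1 + p)" by simp
    show ?thesis using z(3) unfolding e by (simp add: algebra_simps)
  qed
  finally show ?thesis by simp
next
  case False
  have s: "0 < s" using t by simp
  have "S powr (- p) \<le> s powr (- p)"
    using s S p by (intro powr_mono2') auto
  then have "(2 powr p - 1) * S powr (- p) \<le> (2 powr p - 1) * s powr (- p)"
    using p ge_one_powr_ge_zero[of 2 p] by (intro mult_left_mono) auto
  also have "\<dots> = (s / 2) powr (- p) - s powr (- p)"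
    using s by (simp add: powr_divide powr_minus field_simps)
  also have "\<dots> \<le> t powr (- p) - s powr (- p)"
    using False t p by (auto intro!: powr_mono2')
  finally show ?thesis by simp
qed

text \<open>By \<open>powr_neg_increment\<close>, \<open>r k powr (- p)\<close> gains at least a
  fixed \<open>\<mu>\<close> every two steps, hence grows at least linearly. Inverting the power
  gives the rate.\<close>

lemma sublinear_decay_of_two_step_recursion:
  fixes r :: "nat \<Rightarrow> real"
  assumes B: "0 < B" and p: "0 < p" and pos: "\<And>k. 0 < r k" and mono: "\<And>k. r (Suc k) \<le> r k"
    and rec: "\<And>k. N \<le> k \<Longrightarrow> r (Suc (Suc k)) powr (1 + p) \<le> B * (r k - r (Suc (Suc k)))"
  shows "\<exists>C>0. \<forall>k\<ge>2 * N + 2. r k \<le> C * real k powr (- 1 / p)"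
proof -
  define \<mu> where "\<mu> = min (p * 2 powr (- (1 + p)) / B) ((2 powr p - 1) * r N powr (- p))"
  have \<mu>: "0 < \<mu>" using p B pos[of N] by (auto simp: \<mu>_def)
  have anti: "antimono r" using mono by (simp add: decseq_SucI)
  have step: "\<mu> + r k powr (- p) \<le> r (Suc (Suc k)) powr (- p)" if "N \<le> k" for k
  proof -
    have "r (Suc (Suc k)) \<le> r k" using antimonoD[OF anti, of k "Suc (Suc k)"] by simp
    moreover have "r k \<le> r N" using antimonoD[OF anti that] .
    ultimately show ?thesis
      using powr_neg_increment[OF pos _ _ p B rec[OF that], of "r N"] by (simp add: \<mu>_def)
  qed
  \<comment> \<open>The factor 2 reflects a gain only every second step, and the summand
    \<open>\<mu>\<close> covers the odd offset 1, before any gain.\<close>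
  have "\<mu> * real j \<le> 2 * r (N + j) powr (- p) + \<mu> \<and>
      \<mu> * real (Suc j) \<le> 2 * r (N + Suc j) powr (- p) + \<mu>" for j
  proof (induction j)
    case 0
    show ?case using \<mu> by simp
  next
    case (Suc j)
    then show ?case using step[of "N + j"] by (simp add: algebra_simps)
  qed
  then have key: "\<mu> * real j \<le> 2 * r (N + j) powr (- p) + \<mu>" for j by blast
  \<comment> \<open>For \<open>k \<ge> 2 * N + 2\<close> one has
    \<open>k - N - 1 \<ge> k / 2\<close>. With the factor 2 in \<open>key\<close> this yields
    \<open>\<mu> / 4\<close>.\<close>
  have "r k \<le> (\<mu> / 4) powr (- 1 / p) * real k powr (- 1 / p)" if k: "2 * N + 2 \<le> k" for k
  proof -
    have "\<mu> * real (k - N) \<le> 2 * r k powr (- p) + \<mu>"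
      using key[of "k - N"] k by simp
    moreover have "\<mu> * (2 * real N + 2) \<le> \<mu> * real k" using k \<mu> by (intro mult_left_mono) auto
    moreover have "\<mu> * real (k - N) = \<mu> * real k - \<mu> * real N"
      using k by (simp add: of_nat_diff algebra_simps)
    ultimately have "\<mu> / 4 * real k \<le> r k powr (- p)"
      by (simp add: algebra_simps)
    then have "(r k powr (- p)) powr (- 1 / p) \<le> (\<mu> / 4 * real k) powr (- 1 / p)"
      using \<mu> k p by (intro powr_mono2') auto
    then show ?thesis
      using pos[of k] p \<mu> powr_mult[of "\<mu> / 4" "real k" "- 1 / p"] by (simp add: powr_powr)
  qed
  then show ?thesis
    using \<mu> by (intro exI[of _ "(\<mu> / 4) powr (- 1 / p)"]) auto
qed

section \<open>Elementary inequalities for the descent argument\<close>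

text \<open>This is the tangent inequality of the concave function \<open>s powr \<theta>\<close> at
  \<open>r\<close>, multiplied by \<open>r powr (1 - \<theta>)\<close>. In this form it follows from
  weighted AM-GM, and the factor \<open>r powr (1 - \<theta>)\<close> is the one that the KL
  inequality bounds.\<close>

lemma powr_concave_increment:
  fixes t r \<theta> :: real
  assumes "0 < t" "0 < r" "0 \<le> \<theta>" "\<theta> \<le> 1"
  shows "\<theta> * (r - t) \<le> r powr (1 - \<theta>) * (r powr \<theta> - t powr \<theta>)"
proof -
  have "t powr \<theta> * r powr (1 - \<theta>) \<le> \<theta> * t + (1 - \<theta>) * r"
    using assms by (intro Youngs_inequality_0) auto
  moreover have "r powr (1 - \<theta>) * r powr \<theta> = r"
    using assms by (simp flip: powr_add)
  ultimately show ?thesis by (simp add: algebra_simps)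
qed

text \<open>AM-GM bounds the geometric mean of \<open>u\<close> and \<open>d + d'\<close> by
  \<open>u + (d + d') / 4\<close>. With this weight, doubling the resulting bound leaves the
  telescoping term \<open>(d - d') / 2\<close>.\<close>

lemma two_step_lengths_le_of_square_le:
  fixes d d' u :: real
  assumes "d'\<^sup>2 \<le> u * (d + d')" and "0 \<le> u" "0 \<le> d" "0 \<le> d'"
  shows "d' \<le> 2 * u + (d - d') / 2"
proof -
  have "0 \<le> (u - (d + d') / 4)\<^sup>2" by simp
  also have "\<dots> = (u + (d + d') / 4)\<^sup>2 - u * (d + d')"
    by (simp add: power2_eq_square field_simps)
  finally have "d'\<^sup>2 \<le> (u + (d + d') / 4)\<^sup>2" using assms(1) by linarith
  then have "d' \<le> u + (d + d') / 4"
    by (rule power2_le_imp_le) (use assms in auto)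
  then show ?thesis by (simp add: field_simps)
qed

text \<open>Needed because \<open>cond_H3\<close> provides the limit only along a subsequence. Every
  term dominates later terms of the subsequence, so \<open>l\<close> is a lower bound and the whole
  sequence converges.\<close>

lemma antimono_cluster_limit:
  fixes r :: "nat \<Rightarrow> real"
  assumes "antimono r" "strict_mono \<rho>" "(\<lambda>j. r (\<rho> j)) \<longlonglongrightarrow> l"
  shows "r \<longlonglongrightarrow> l"
proof -
  have low: "l \<le> r k" for k
  proof (rule LIMSEQ_le_const2[OF assms(3)])
    show "\<exists>N. \<forall>n\<ge>N. r (\<rho> n) \<le> r k"
      using antimonoD[OF assms(1)] seq_suble[OF assms(2)] by (metis order_trans)
  qed
  obtain l' where l': "r \<longlonglongrightarrow> l'"
    using decseq_convergent[OF assms(1), of l] low by blast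
  with assms(2,3) have "l' = l"
    using LIMSEQ_subseq_LIMSEQ[OF l' assms(2)] LIMSEQ_unique by (auto simp: o_def)
  with l' show ?thesis by simp
qed

section \<open>Abstract descent sequences under a KL inequality\<close>

text \<open>\<open>gap_pos\<close> loses nothing: once the gap vanishes, descent makes the iterates stationary.\<close>

locale KL_descent =
  fixes x :: "nat \<Rightarrow> 'a::real_normed_vector" and xs :: 'a and r :: "nat \<Rightarrow> real"
    and a M \<theta> \<epsilon> \<eta> :: real and d :: "nat \<Rightarrow> real"
  assumes d_def: "\<And>k. d k = norm (x k - x (k - 1))"
    and a: "0 < a" and M: "0 < M" and \<theta>: "0 < \<theta>" "\<theta> \<le> 1" and \<epsilon>: "0 < \<epsilon>" and \<eta>: "0 < \<eta>"
    and gap_pos: "\<And>k. 0 < r k"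
    and gap_lim: "r \<longlonglongrightarrow> 0"
    and descent: "\<And>k. a * (d k)\<^sup>2 \<le> r k - r (Suc k)"
    and KL: "\<And>k. \<lbrakk>norm (x k - xs) < \<epsilon>; norm (x (Suc k) - xs) < \<epsilon>; r (Suc k) < \<eta>\<rbrakk> \<Longrightarrow>
      r (Suc k) powr (1 - \<theta>) \<le> M * (d k + d (Suc k))"
    and cluster: "\<exists>\<rho>. strict_mono \<rho> \<and> (\<lambda>j. x (\<rho> j)) \<longlonglongrightarrow> xs"
begin

definition K where "K = M / (a * \<theta>)"

text \<open>The coefficients are chosen so that the right side of
  \<open>two_step_lengths_le_of_square_le\<close> becomes exactly \<open>P k - P (Suc k)\<close>.
  The gap is taken at \<open>Suc k\<close> because the KL inequality bounding
  \<open>d (Suc k)\<close> is evaluated there.\<close>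

definition P where "P k = 2 * K * r (Suc k) powr \<theta> + d k / 2"

lemma d_nonneg: "0 \<le> d k"
  by (simp add: d_def)

lemma K_pos: "0 < K"
  using a M \<theta> by (simp add: K_def)

lemma P_nonneg: "0 \<le> P k"
  using K_pos d_nonneg by (simp add: P_def)

lemma gap_mono: "r (Suc k) \<le> r k"
  using descent[of k] a by (smt (verit) mult_nonneg_nonneg zero_le_power2)

lemma gap_antimono: "antimono r"
  using gap_mono by (simp add: decseq_SucI)

lemma step_le_sqrt_gap: "d k \<le> sqrt (r k / a)"
proof (rule real_le_rsqrt)
  show "(d k)\<^sup>2 \<le> r k / a"
    using descent[of k] gap_pos[of "Suc k"] a by (simp add: field_simps)
qed

lemma step_tendsto: "d \<longlonglongrightarrow> 0"
proof (rule tendsto_sandwich[of "\<lambda>_. 0" d sequentially "\<lambda>k. sqrt (r k / a)"])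
  have "(\<lambda>k. sqrt (r k / a)) \<longlonglongrightarrow> sqrt (0 / a)"
    using a by (intro tendsto_intros gap_lim) auto
  then show "(\<lambda>k. sqrt (r k / a)) \<longlonglongrightarrow> 0" by simp
qed (auto simp: d_nonneg step_le_sqrt_gap)

lemma gap_powr_tendsto: "(\<lambda>k. r k powr \<theta>) \<longlonglongrightarrow> 0"
proof -
  have "(\<lambda>k. r k powr \<theta>) \<longlonglongrightarrow> 0 powr \<theta>"
    using \<theta> gap_pos by (intro tendsto_powr2 gap_lim) (auto simp: less_imp_le)
  then show ?thesis using \<theta> by simp
qed

lemma P_tendsto: "P \<longlonglongrightarrow> 0"
proof -
  have "(\<lambda>k. 2 * K * r (Suc k) powr \<theta> + d k / 2) \<longlonglongrightarrow> 2 * K * 0 + 0 / 2"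
    by (intro tendsto_intros step_tendsto LIMSEQ_Suc[OF gap_powr_tendsto]) auto
  then show ?thesis by (simp add: P_def[abs_def])
qed

text \<open>Expresses the potential through the gap alone, so that decay of \<open>r\<close> carries
  over to the distances.\<close>

lemma P_le: "P k \<le> 2 * K * r k powr \<theta> + sqrt (r k / a) / 2"
proof -
  have "r (Suc k) powr \<theta> \<le> r k powr \<theta>"
    using gap_mono gap_pos[of "Suc k"] \<theta> by (intro powr_mono2) auto
  then have "2 * K * r (Suc k) powr \<theta> \<le> 2 * K * r k powr \<theta>"
    using K_pos by (intro mult_left_mono) auto
  then show ?thesis using step_le_sqrt_gap[of k] by (simp add: P_def)
qed

text \<open>Descent bounds the squared step by a gap decrease, concavity turns this into
  \<open>?\<Delta>\<close> times \<open>?r powr (1 - \<theta>)\<close>, and the KL inequality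
  replaces that power by two step lengths. The square is then removed by AM-GM.\<close>

lemma step_le_P_diff:
  assumes "r (Suc k) powr (1 - \<theta>) \<le> M * (d k + d (Suc k))"
  shows "d (Suc k) \<le> P k - P (Suc k)"
proof -
  let ?r = "r (Suc k)" and ?t = "r (Suc (Suc k))"
  let ?\<Delta> = "?r powr \<theta> - ?t powr \<theta>"
  have \<Delta>: "0 \<le> ?\<Delta>"
    using gap_mono[of "Suc k"] gap_pos[of "Suc (Suc k)"] \<theta> by (simp add: powr_mono2)
  have "\<theta> * (a * (d (Suc k))\<^sup>2) \<le> \<theta> * (?r - ?t)"
    using descent[of "Suc k"] \<theta> by (intro mult_left_mono) auto
  also have "\<dots> \<le> ?r powr (1 - \<theta>) * ?\<Delta>"
    using gap_pos \<theta> by (intro powr_concave_increment) auto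
  also have "\<dots> \<le> M * (d k + d (Suc k)) * ?\<Delta>"
    using assms \<Delta> by (intro mult_right_mono)
  finally have "(d (Suc k))\<^sup>2 \<le> (K * ?\<Delta>) * (d k + d (Suc k))"
    using a \<theta> by (simp add: K_def field_simps)
  then have "d (Suc k) \<le> 2 * (K * ?\<Delta>) + (d k - d (Suc k)) / 2"
    using \<Delta> K_pos d_nonneg by (intro two_step_lengths_le_of_square_le) auto
  then show ?thesis by (simp add: P_def algebra_simps diff_divide_distrib)
qed

text \<open>The quantity \<open>norm (x n - xs) + P n\<close> cannot increase as long as the iterates stay in the
  ball of the KL inequality, which in turn keeps them there.\<close>

lemma eventually_trapped:
  obtains N where "\<And>n. N \<le> n \<Longrightarrow> r (Suc n) powr (1 - \<theta>) \<le> M * (d n + d (Suc n))"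
proof -
  obtain \<rho> where \<rho>: "strict_mono \<rho>" "(\<lambda>j. x (\<rho> j)) \<longlonglongrightarrow> xs"
    using cluster by blast
  have "eventually (\<lambda>k. P k < \<epsilon> / 4 \<and> d k < \<epsilon> / 2 \<and> r k < \<eta>) sequentially"
    using \<epsilon> \<eta>
    by (intro eventually_conj order_tendstoD(2)[OF P_tendsto] order_tendstoD(2)[OF step_tendsto]
        order_tendstoD(2)[OF gap_lim]) auto
  then obtain N0 where N0: "\<And>k. N0 \<le> k \<Longrightarrow> P k < \<epsilon> / 4 \<and> d k < \<epsilon> / 2 \<and> r k < \<eta>"
    unfolding eventually_sequentially by blast
  have "eventually (\<lambda>j. dist (x (\<rho> j)) xs < \<epsilon> / 4) sequentially"
    using \<rho>(2) \<epsilon> by (intro tendstoD) auto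
  then obtain j0 where j0: "\<And>j. j0 \<le> j \<Longrightarrow> dist (x (\<rho> j)) xs < \<epsilon> / 4"
    unfolding eventually_sequentially by blast
  \<comment> \<open>Since \<open>\<rho> m \<ge> m\<close>, this index lies beyond \<open>N0\<close>
    and belongs to the subsequence close to \<open>xs\<close>. Both terms of
    \<open>norm (x N - xs) + P N\<close> are then below \<open>\<epsilon> / 4\<close>.\<close>
  define N where "N = \<rho> (max j0 N0)"
  have N: "norm (x N - xs) < \<epsilon> / 4" "N0 \<le> N"
    using j0[of "max j0 N0"] seq_suble[OF \<rho>(1), of "max j0 N0"]
    by (auto simp: N_def dist_norm)
  have close_imp: "r (Suc n) powr (1 - \<theta>) \<le> M * (d n + d (Suc n)) \<and>
      norm (x (Suc n) - xs) + P (Suc n) \<le> \<epsilon> / 2"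
    if "N \<le> n" "norm (x n - xs) + P n \<le> \<epsilon> / 2" for n
  proof -
    \<comment> \<open>The KL inequality already requires \<open>x (Suc n)\<close> to be in the ball.
      The crude bound \<open>d (Suc n) < \<epsilon> / 2\<close> ensures this, and only afterwards
      does the potential sharpen the estimate back to \<open>\<epsilon> / 2\<close>.\<close>
    have tri: "norm (x (Suc n) - xs) \<le> d (Suc n) + norm (x n - xs)"
      using norm_triangle_ineq[of "x (Suc n) - x n" "x n - xs"] by (simp add: d_def)
    have "r (Suc n) < \<eta>" "d (Suc n) < \<epsilon> / 2"
      using N0[of "Suc n"] N(2) that(1) by auto
    then have "r (Suc n) powr (1 - \<theta>) \<le> M * (d n + d (Suc n))"
      using tri that(2) P_nonneg[of n] \<epsilon> by (intro KL) auto
    with step_le_P_diff[OF this] tri that(2) show ?thesis by auto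
  qed
  have "norm (x n - xs) + P n \<le> \<epsilon> / 2" if "N \<le> n" for n
    using that
  proof (induction n rule: dec_induct)
    case base
    show ?case using N N0[of N] by auto
  next
    case (step n)
    then show ?case using close_imp by blast
  qed
  then show ?thesis using close_imp that by blast
qed

text \<open>The step bounds telescope to \<open>norm (x n - x m) \<le> P n - P m\<close>. Dropping
  \<open>P m\<close> and letting \<open>m\<close> run along the subsequence bounds the distance to
  \<open>xs\<close> by \<open>P n\<close>.\<close>

lemma distance_le_gap:
  "\<exists>N. \<forall>n\<ge>N. norm (x n - xs) \<le> 2 * K * r n powr \<theta> + sqrt (r n / a) / 2"
proof -
  obtain N where N: "\<And>n. N \<le> n \<Longrightarrow> r (Suc n) powr (1 - \<theta>) \<le> M * (d n + d (Suc n))"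
    using eventually_trapped by blast
  obtain \<rho> where \<rho>: "strict_mono \<rho>" "(\<lambda>j. x (\<rho> j)) \<longlonglongrightarrow> xs"
    using cluster by blast
  have "norm (x n - xs) \<le> P n" if n: "N \<le> n" for n
  proof -
    have diff: "norm (x n - x m) \<le> P n - P m" if "n \<le> m" for m
      using that
    proof (induction m rule: dec_induct)
      case base
      show ?case by simp
    next
      case (step m)
      have "norm (x n - x (Suc m)) \<le> norm (x n - x m) + d (Suc m)"
        using norm_triangle_ineq4[of "x n - x m" "x (Suc m) - x m"] by (simp add: d_def)
      then show ?case
        using step step_le_P_diff[OF N[of m]] n by simp
    qed
    have "(\<lambda>j. norm (x n - x (\<rho> j))) \<longlonglongrightarrow> norm (x n - xs)"
      by (intro tendsto_intros \<rho>)
    moreover have "\<exists>J. \<forall>j\<ge>J. norm (x n - x (\<rho> j)) \<le> P n"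
    proof (intro exI[of _ n] allI impI)
      fix j assume "n \<le> j"
      then have "n \<le> \<rho> j" using seq_suble[OF \<rho>(1), of j] by simp
      from diff[OF this] P_nonneg[of "\<rho> j"] show "norm (x n - x (\<rho> j)) \<le> P n" by simp
    qed
    ultimately show ?thesis by (rule LIMSEQ_le_const2)
  qed
  then show ?thesis using P_le by (meson order_trans)
qed

text \<open>Two consecutive descent inequalities add up to \<open>r n - r (Suc (Suc n))\<close>,
  which is why two steps are needed. Monotonicity moves the left side to the same later
  index.\<close>

lemma gap_recursion:
  "\<exists>N. \<forall>n\<ge>N. r (Suc (Suc n)) powr (2 - 2 * \<theta>) \<le> 2 * M\<^sup>2 / a * (r n - r (Suc (Suc n)))"
proof -
  obtain N where N: "\<And>n. N \<le> n \<Longrightarrow> r (Suc n) powr (1 - \<theta>) \<le> M * (d n + d (Suc n))"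
    using eventually_trapped by blast
  have "r (Suc (Suc n)) powr (2 - 2 * \<theta>) \<le> 2 * M\<^sup>2 / a * (r n - r (Suc (Suc n)))"
    if n: "N \<le> n" for n
  proof -
    have "r (Suc (Suc n)) powr (2 - 2 * \<theta>) \<le> r (Suc n) powr (2 - 2 * \<theta>)"
      using gap_mono gap_pos[of "Suc (Suc n)"] \<theta> by (intro powr_mono2) auto
    also have "\<dots> = (r (Suc n) powr (1 - \<theta>))\<^sup>2"
      by (simp add: power2_eq_square flip: powr_add)
    also have "\<dots> \<le> (M * (d n + d (Suc n)))\<^sup>2"
      using N[OF n] by (intro power_mono) auto
    also have "\<dots> \<le> M\<^sup>2 * (2 * ((d n)\<^sup>2 + (d (Suc n))\<^sup>2))"
    proof -
      have "(d n + d (Suc n))\<^sup>2 \<le> 2 * ((d n)\<^sup>2 + (d (Suc n))\<^sup>2)"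
        using zero_le_power2[of "d n - d (Suc n)"] by (simp add: power2_eq_square algebra_simps)
      then show ?thesis by (simp add: power_mult_distrib mult_left_mono)
    qed
    also have "\<dots> \<le> M\<^sup>2 * (2 * ((r n - r (Suc (Suc n))) / a))"
      using descent[of n] descent[of "Suc n"] a
      by (intro mult_left_mono) (auto simp: field_simps)
    finally show ?thesis by (simp add: algebra_simps)
  qed
  then show ?thesis by blast
qed

text \<open>For exponent 1 the left side of \<open>gap_recursion\<close> is the zeroth power of a
  positive gap, hence 1, while the right side tends to 0.\<close>

lemma exponent_neq_1: "\<theta> \<noteq> 1"
proof
  assume 1: "\<theta> = 1"
  obtain N where N: "\<And>n. N \<le> n \<Longrightarrow> 1 \<le> 2 * M\<^sup>2 / a * (r n - r (Suc (Suc n)))"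
    using gap_recursion gap_pos 1 by (auto simp: order_less_imp_not_eq2)
  have "(\<lambda>n. 2 * M\<^sup>2 / a * (r n - r (Suc (Suc n)))) \<longlonglongrightarrow> 2 * M\<^sup>2 / a * (0 - 0)"
    by (intro tendsto_intros gap_lim LIMSEQ_Suc)
  with N have "(1::real) \<le> 2 * M\<^sup>2 / a * (0 - 0)" by (intro LIMSEQ_le_const) auto
  then show False by simp
qed

text \<open>Once \<open>r k < 1\<close>, the exponent \<open>2 - 2 * \<theta> \<le> 1\<close> makes
  the recursion linear. Also \<open>r k powr \<theta> \<le> sqrt (r k)\<close>, so the distance
  decays at the rate \<open>sqrt q\<close>, which serves for the gap as well.\<close>

lemma linear_case:
  assumes "1 / 2 \<le> \<theta>"
  shows "\<exists>C q. 0 < q \<and> q < 1 \<and>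
    (\<forall>\<^sub>F k in sequentially. r k \<le> C * q ^ k \<and> norm (x k - xs) \<le> C * q ^ k)"
proof -
  let ?B = "2 * M\<^sup>2 / a"
  obtain N1 where N1: "\<And>n. N1 \<le> n \<Longrightarrow>
      r (Suc (Suc n)) powr (2 - 2 * \<theta>) \<le> ?B * (r n - r (Suc (Suc n)))"
    using gap_recursion by blast
  have "eventually (\<lambda>k. r k < 1) sequentially"
    by (intro order_tendstoD(2)[OF gap_lim]) auto
  then obtain N2 where N2: "\<And>n. N2 \<le> n \<Longrightarrow> r n < 1"
    unfolding eventually_sequentially by blast
  obtain N3 where N3: "\<And>n. N3 \<le> n \<Longrightarrow>
      norm (x n - xs) \<le> 2 * K * r n powr \<theta> + sqrt (r n / a) / 2"
    using distance_le_gap by blast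
  have "r (Suc (Suc n)) \<le> ?B * (r n - r (Suc (Suc n)))" if "max N1 N2 \<le> n" for n
  proof -
    have "r (Suc (Suc n)) powr 1 \<le> r (Suc (Suc n)) powr (2 - 2 * \<theta>)"
      using gap_pos[of "Suc (Suc n)"] N2[of "Suc (Suc n)"] that assms
      by (intro powr_mono') auto
    then show ?thesis using N1[of n] that gap_pos[of "Suc (Suc n)"] by simp
  qed
  then obtain C q where q: "0 < q" "q < 1"
    and C: "0 \<le> C" "\<And>k. max N1 N2 \<le> k \<Longrightarrow> r k \<le> C * q ^ k"
    using linear_decay_of_two_step_contraction[of ?B r "max N1 N2"] a M gap_mono gap_pos
    by (force simp: less_imp_le)
  let ?E = "2 * K + sqrt (1 / a) / 2"
  let ?C = "max C (?E * sqrt C)" and ?q = "sqrt q"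
  have E: "0 \<le> ?E" using K_pos a by auto
  have "r k \<le> ?C * ?q ^ k \<and> norm (x k - xs) \<le> ?C * ?q ^ k" if k: "max (max N1 N2) N3 \<le> k" for k
  proof
    have "q \<le> ?q" using q by (simp add: real_le_rsqrt power2_eq_square mult_left_le)
    then have "C * q ^ k \<le> ?C * ?q ^ k"
      using q C by (intro mult_mono power_mono) auto
    then show "r k \<le> ?C * ?q ^ k" using C(2)[of k] k by auto
    have "r k powr \<theta> \<le> r k powr (1 / 2)"
      using gap_pos[of k] N2[of k] k assms by (intro powr_mono') auto
    then have "r k powr \<theta> \<le> sqrt (r k)"
      using gap_pos[of k] by (simp add: powr_half_sqrt)
    then have "2 * K * r k powr \<theta> \<le> 2 * K * sqrt (r k)"
      using K_pos by (intro mult_left_mono) auto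
    then have "norm (x k - xs) \<le> ?E * sqrt (r k)"
      using N3[of k] k by (simp add: real_sqrt_divide algebra_simps)
    also have "\<dots> \<le> ?E * sqrt (C * q ^ k)"
      using E C(2)[of k] k by (intro mult_left_mono) auto
    also have "\<dots> = (?E * sqrt C) * ?q ^ k"
      by (simp add: real_sqrt_mult real_sqrt_power)
    also have "\<dots> \<le> ?C * ?q ^ k" using q by (intro mult_right_mono) auto
    finally show "norm (x k - xs) \<le> ?C * ?q ^ k" .
  qed
  then have "\<forall>\<^sub>F k in sequentially. r k \<le> ?C * ?q ^ k \<and> norm (x k - xs) \<le> ?C * ?q ^ k"
    unfolding eventually_sequentially by blast
  moreover have "0 < ?q" "?q < 1" using q by auto
  ultimately show ?thesis by blast
qed

text \<open>The recursion has exponent \<open>1 + ?p\<close> with \<open>?p > 0\<close>. In contrast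
  to the linear case, \<open>r k powr \<theta>\<close> now dominates \<open>sqrt (r k)\<close> for
  gaps below 1, so the distance rate is the gap rate raised to the power
  \<open>\<theta>\<close>.\<close>

lemma sublinear_case:
  assumes "\<theta> < 1 / 2"
  shows "r \<in> O(\<lambda>k. real k powr (1 / (2 * \<theta> - 1)))"
    and "(\<lambda>k. norm (x k - xs)) \<in> O(\<lambda>k. real k powr (\<theta> / (2 * \<theta> - 1)))"
proof -
  let ?B = "2 * M\<^sup>2 / a" and ?p = "1 - 2 * \<theta>"
  have exps: "- 1 / ?p = 1 / (2 * \<theta> - 1)"
    by (metis minus_diff_eq minus_divide_divide minus_divide_left)
  obtain N1 where N1: "\<And>n. N1 \<le> n \<Longrightarrow>
      r (Suc (Suc n)) powr (2 - 2 * \<theta>) \<le> ?B * (r n - r (Suc (Suc n)))"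
    using gap_recursion by blast
  then have "\<And>n. N1 \<le> n \<Longrightarrow>
      r (Suc (Suc n)) powr (1 + ?p) \<le> ?B * (r n - r (Suc (Suc n)))"
    by (simp add: algebra_simps)
  then obtain C where C: "0 < C" "\<And>k. 2 * N1 + 2 \<le> k \<Longrightarrow> r k \<le> C * real k powr (- 1 / ?p)"
    using sublinear_decay_of_two_step_recursion[of ?B ?p r N1] a M assms gap_pos gap_mono by auto
  have gap: "eventually (\<lambda>k. r k \<le> C * real k powr (1 / (2 * \<theta> - 1))) sequentially"
    using C(2) unfolding eventually_sequentially exps by blast
  then show "r \<in> O(\<lambda>k. real k powr (1 / (2 * \<theta> - 1)))"
    using gap_pos by (intro bigoI[of _ C]) (simp add: abs_of_pos)
  have "eventually (\<lambda>k. r k < 1) sequentially"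
    by (intro order_tendstoD(2)[OF gap_lim]) auto
  moreover have "eventually (\<lambda>k. norm (x k - xs) \<le> 2 * K * r k powr \<theta> + sqrt (r k / a) / 2)
      sequentially"
    using distance_le_gap by (auto simp: eventually_sequentially)
  ultimately have "eventually (\<lambda>k. norm (norm (x k - xs)) \<le>
      ((2 * K + sqrt (1 / a) / 2) * C powr \<theta>) * norm (real k powr (\<theta> / (2 * \<theta> - 1)))) sequentially"
    using gap
  proof eventually_elim
    case (elim k)
    have "r k powr (1 / 2) \<le> r k powr \<theta>"
      using gap_pos[of k] elim assms by (intro powr_mono') auto
    then have "sqrt (1 / a) / 2 * sqrt (r k) \<le> sqrt (1 / a) / 2 * r k powr \<theta>"
      using gap_pos[of k] a by (intro mult_left_mono) (auto simp: powr_half_sqrt)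
    then have "norm (x k - xs) \<le> (2 * K + sqrt (1 / a) / 2) * r k powr \<theta>"
      using elim(2) by (simp add: real_sqrt_divide algebra_simps)
    also have "\<dots> \<le> (2 * K + sqrt (1 / a) / 2) * (C * real k powr (1 / (2 * \<theta> - 1))) powr \<theta>"
      using elim(3) gap_pos[of k] \<theta> K_pos a by (intro mult_left_mono powr_mono2) auto
    also have "\<dots> = ((2 * K + sqrt (1 / a) / 2) * C powr \<theta>) * real k powr (\<theta> / (2 * \<theta> - 1))"
      using C(1) by (simp add: powr_mult powr_powr)
    finally show ?case by simp
  qed
  then show "(\<lambda>k. norm (x k - xs)) \<in> O(\<lambda>k. real k powr (\<theta> / (2 * \<theta> - 1)))"
    by (rule bigoI)
qed

end

section \<open>From eventual bounds and the KL property to usable inequalities\<close>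

lemma linear_rate_of_eventually_le:
  fixes e :: "nat \<Rightarrow> real"
  assumes q: "0 < q" "q < 1" and ev: "\<forall>\<^sub>F k in sequentially. e k \<le> C * q ^ k"
  shows "linear_rate (\<lambda>k. ereal (e k))"
proof -
  obtain N where N: "\<And>k. N \<le> k \<Longrightarrow> e k \<le> C * q ^ k"
    using ev unfolding eventually_sequentially by blast
  \<comment> \<open>\<open>linear_rate\<close> demands a bound for every \<open>k\<close>, so the
    sum absorbs the initial terms.\<close>
  let ?C = "\<bar>C\<bar> + (\<Sum>k<N. \<bar>e k\<bar> / q ^ k)"
  have S: "0 \<le> (\<Sum>k<N. \<bar>e k\<bar> / q ^ k)" using q by (intro sum_nonneg) auto
  have "e k \<le> ?C * q ^ k" for k
  proof (cases "N \<le> k")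
    case True
    have "C * q ^ k \<le> ?C * q ^ k"
      using q S by (intro mult_right_mono) auto
    with N[OF True] show ?thesis by simp
  next
    case False
    then have "\<bar>e k\<bar> / q ^ k \<le> (\<Sum>k<N. \<bar>e k\<bar> / q ^ k)"
      using q by (intro member_le_sum[of k "{..<N}" "\<lambda>k. \<bar>e k\<bar> / q ^ k"]) auto
    then have "\<bar>e k\<bar> / q ^ k * q ^ k \<le> ?C * q ^ k"
      using q by (intro mult_right_mono) auto
    then show ?thesis using q by simp
  qed
  then show ?thesis
    unfolding linear_rate_def using q S by (intro exI[of _ ?C] exI[of _ q]) auto
qed

lemma deriv_power_desingularizer:
  fixes c s \<theta> :: real
  assumes "0 < s" "\<theta> \<noteq> 0"
  shows "deriv (\<lambda>s. c / \<theta> * s powr \<theta>) s = c * s powr (\<theta> - 1)"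
  by (rule DERIV_imp_deriv) (use assms in \<open>auto intro!: derivative_eq_intros\<close>)

text \<open>The derivative of the desingularizing function is
  \<open>c * s powr (\<theta> - 1)\<close>, and multiplying by \<open>s powr (1 - \<theta>)\<close>
  isolates the subgradient norm. A smaller real \<open>\<eta>\<close> replaces the possibly infinite
  one.\<close>

lemma KL_exponent_neighborhood:
  assumes "KL_exponent H z \<theta>"
  obtains c \<eta> V where "0 < c" "0 < \<eta>" "open V" "z \<in> V"
    "\<And>y v s. \<lbrakk>y \<in> V; H y = H z + ereal s; 0 < s; s < \<eta>; v \<in> limiting_subdiff H y\<rbrakk>
      \<Longrightarrow> s powr (1 - \<theta>) \<le> c * norm v"
proof -
  have \<theta>: "0 < \<theta>" using assms by (simp add: KL_exponent_def)
  obtain \<eta>' :: ereal and c where c: "0 < c"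
    and KL: "KL_property_with H z \<eta>' (\<lambda>s. c / \<theta> * s powr \<theta>)"
    using assms unfolding KL_exponent_def by blast
  then have \<eta>': "0 < \<eta>'" and fin: "\<bar>H z\<bar> \<noteq> \<infinity>"
    by (auto simp: KL_property_with_def limiting_subdiff_def)
  obtain \<eta> where \<eta>: "0 < \<eta>" "ereal \<eta> < \<eta>'"
    using ereal_dense2[OF \<eta>'] by (auto simp: zero_ereal_def)
  obtain V where V: "open V" "z \<in> V"
    "\<And>y. \<lbrakk>y \<in> V; H z < H y; H y < H z + \<eta>'\<rbrakk> \<Longrightarrow>
       1 \<le> ereal (deriv (\<lambda>s. c / \<theta> * s powr \<theta>) (real_of_ereal (H y - H z))) *
         (INF v\<in>limiting_subdiff H y. ereal (norm v))"
    using KL unfolding KL_property_with_def by blast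
  have "s powr (1 - \<theta>) \<le> c * norm v"
    if y: "y \<in> V" "H y = H z + ereal s" and s: "0 < s" "s < \<eta>" and v: "v \<in> limiting_subdiff H y"
    for y v s
  proof -
    obtain hz where hz: "H z = ereal hz" using fin by auto
    have "ereal s < \<eta>'" using s \<eta>(2) by (metis less_ereal.simps(1) order_less_trans)
    have "1 \<le> ereal (c * s powr (\<theta> - 1)) * (INF v\<in>limiting_subdiff H y. ereal (norm v))"
    proof -
      have "H z < H y" "H y < H z + \<eta>'"
        using y(2) s(1) \<open>ereal s < \<eta>'\<close> by (cases \<eta>'; simp add: hz)+
      then show ?thesis
        using V(3)[OF y(1)] y(2) deriv_power_desingularizer[OF s(1), of \<theta> c] \<theta>
        by (simp only: hz) simp
    qed
    also have "\<dots> \<le> ereal (c * s powr (\<theta> - 1)) * ereal (norm v)"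
      using c v by (intro ereal_mult_left_mono INF_lower) auto
    finally have "1 \<le> c * s powr (\<theta> - 1) * norm v" by (simp add: one_ereal_def)
    then have "s powr (1 - \<theta>) * 1 \<le> s powr (1 - \<theta>) * (c * s powr (\<theta> - 1) * norm v)"
      by (intro mult_left_mono) auto
    also have "\<dots> = (s powr (1 - \<theta>) * s powr (\<theta> - 1)) * (c * norm v)" by simp
    also have "\<dots> = c * norm v" using s by (simp flip: powr_add)
    finally show ?thesis by simp
  qed
  with that c \<eta>(1) V(1,2) show ?thesis by blast
qed

lemma open_contains_product_ball:
  fixes p :: "'a::real_normed_vector"
  assumes "open V" "(p, p) \<in> V"
  obtains \<epsilon> where "0 < \<epsilon>" "\<And>y z. \<lbrakk>norm (y - p) < \<epsilon>; norm (z - p) < \<epsilon>\<rbrakk> \<Longrightarrow> (y, z) \<in> V"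
proof -
  obtain A B where AB: "open A" "open B" "(p, p) \<in> A \<times> B" "A \<times> B \<subseteq> V"
    using open_prod_elim[OF assms] by blast
  moreover obtain \<epsilon>1 where "0 < \<epsilon>1" "ball p \<epsilon>1 \<subseteq> A"
    using AB openE[of A p] by auto
  moreover obtain \<epsilon>2 where "0 < \<epsilon>2" "ball p \<epsilon>2 \<subseteq> B"
    using AB openE[of B p] by auto
  ultimately show ?thesis
    by (intro that[of "min \<epsilon>1 \<epsilon>2"]) (auto simp: dist_norm norm_minus_commute subset_iff)
qed

section \<open>Application to iPiano\<close>

theorem corollary16:
  fixes f :: "real ^ 'n \<Rightarrow> real" and df :: "real ^ 'n \<Rightarrow> real ^ 'n"
    and g h :: "real ^ 'n \<Rightarrow> ereal" and U :: "(real ^ 'n) set"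
    and x :: "nat \<Rightarrow> real ^ 'n" and xs :: "real ^ 'n"
    and L \<alpha> \<beta> \<kappa> a b \<theta> :: real
  assumes "ipiano_problem U L f df g h"
    and "ipiano_params U L f g \<alpha> \<beta>"
    and "ipiano_seq U df g h \<alpha> \<beta> x"
    and "0 < \<kappa>" and "0 < a" and "0 < b"
    and "cond_H1 (Hfun h \<kappa>) a x"
    and "cond_H2 (Hfun h \<kappa>) b x"
    and "cond_H3 (Hfun h \<kappa>) x (xs, xs)"
    and "KL_exponent (Hfun h \<kappa>) (xs, xs) \<theta>"
  shows "(\<theta> = 1 \<longrightarrow> (\<exists>K. \<forall>k\<ge>K. x k = xs)) \<and>
    (1 / 2 \<le> \<theta> \<and> \<theta> < 1 \<longrightarrow>
       linear_rate (\<lambda>k. \<bar>h (x k) - h xs\<bar>) \<and>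
       linear_rate (\<lambda>k. ereal (norm (x k - xs)))) \<and>
    (0 < \<theta> \<and> \<theta> < 1 / 2 \<longrightarrow>
       (\<lambda>k. real_of_ereal (h (x k) - h xs)) \<in> O(\<lambda>k. real k powr (1 / (2 * \<theta> - 1))) \<and>
       (\<lambda>k. norm (x k - xs)) \<in> O(\<lambda>k. real k powr (\<theta> / (2 * \<theta> - 1))))"
proof -
  let ?H = "Hfun h \<kappa>"
  define d where "d k = norm (x k - x (k - 1))" for k
  have \<theta>: "0 < \<theta>" "\<theta> \<le> 1" using assms(10) by (auto simp: KL_exponent_def)
  have Hz: "?H (zseq x k) = h (x k) + ereal (\<kappa> * (d k)\<^sup>2)" for k
    by (simp add: Hfun_def zseq_def d_def)
  have Hs: "?H (xs, xs) = h xs" by (simp add: Hfun_def)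
  have ninf: "h y \<noteq> -\<infinity>" for y
    using assms(1) by (auto simp: ipiano_problem_def proper_on_def)
  have H1: "h (x (Suc k)) + ereal (\<kappa> * (d (Suc k))\<^sup>2) + ereal (a * (d k)\<^sup>2)
      \<le> h (x k) + ereal (\<kappa> * (d k)\<^sup>2)" for k
    using assms(7) unfolding cond_H1_def Hz d_def[symmetric] by blast
  have "h (x k) < \<infinity>" for k
  proof (induction k)
    case 0
    show ?case using assms(3) by (auto simp: ipiano_seq_def edom_def)
  next
    case (Suc k)
    then show ?case using H1[of k] by (cases "h (x k)"; cases "h (x (Suc k))") auto
  qed
  then have "\<exists>v. h (x k) = ereal v" for k
    using ninf[of "x k"] by (cases "h (x k)") auto
  then obtain hr where hr: "\<And>k. h (x k) = ereal (hr k)" by metis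
  \<comment> \<open>The KL property includes a nonempty limiting subdifferential at
    \<open>(xs, xs)\<close>, which forces a finite value there.\<close>
  have "\<bar>h xs\<bar> \<noteq> \<infinity>"
    using assms(10) by (auto simp: KL_exponent_def KL_property_with_def limiting_subdiff_def Hs)
  then obtain hs where hs: "h xs = ereal hs" by auto
  \<comment> \<open>The gap is measured for \<open>?H\<close>, which descends by
    \<open>cond_H1\<close>; the values of \<open>h\<close> alone need not be monotone.\<close>
  define r where "r k = hr k + \<kappa> * (d k)\<^sup>2 - hs" for k
  have Hr: "?H (zseq x k) = h xs + ereal (r k)" for k
    by (simp add: Hz hr hs r_def)
  have descent: "a * (d k)\<^sup>2 \<le> r k - r (Suc k)" for k
    using H1[of k] by (simp add: hr r_def)
  have mono: "r (Suc k) \<le> r k" for k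
    using descent[of k] \<open>0 < a\<close> by (smt (verit) mult_nonneg_nonneg zero_le_power2)
  have anti: "antimono r" using mono by (simp add: decseq_SucI)
  obtain \<rho> where \<rho>: "strict_mono \<rho>" "(\<lambda>j. zseq x (\<rho> j)) \<longlonglongrightarrow> (xs, xs)"
    "(\<lambda>j. ?H (zseq x (\<rho> j))) \<longlonglongrightarrow> ?H (xs, xs)"
    using assms(9) unfolding cond_H3_def by blast
  have x\<rho>: "(\<lambda>j. x (\<rho> j)) \<longlonglongrightarrow> xs"
    using tendsto_fst[OF \<rho>(2)] by (simp add: zseq_def)
  have "(\<lambda>j. hs + r (\<rho> j)) \<longlonglongrightarrow> hs"
    using \<rho>(3) unfolding Hr Hs hs by simp
  from tendsto_diff[OF this tendsto_const[of hs]] have "(\<lambda>j. r (\<rho> j)) \<longlonglongrightarrow> 0" by simp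
  then have lim: "r \<longlonglongrightarrow> 0" using antimono_cluster_limit[OF anti \<rho>(1)] by blast
  have nonneg: "0 \<le> r k" for k
    using decseq_ge[OF anti lim] .
  have hdiff: "h (x k) - h xs = ereal (hr k - hs)" for k
    by (simp add: hr hs)
  \<comment> \<open>Transfers rates from \<open>r\<close> to \<open>h\<close>. The difference may be
    negative, but by at most \<open>\<kappa> * (d k)\<^sup>2\<close>, which descent bounds by a
    multiple of \<open>r k\<close>.\<close>
  have err: "\<bar>hr k - hs\<bar> \<le> (1 + \<kappa> / a) * r k" for k
  proof -
    have "(d k)\<^sup>2 \<le> r k / a"
      using descent[of k] nonneg[of "Suc k"] \<open>0 < a\<close> by (simp add: field_simps)
    then have "\<kappa> * (d k)\<^sup>2 \<le> \<kappa> * (r k / a)" using \<open>0 < \<kappa>\<close> by (intro mult_left_mono) auto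
    moreover have "0 \<le> \<kappa> * (d k)\<^sup>2" using \<open>0 < \<kappa>\<close> by simp
    moreover have "hr k - hs = r k - \<kappa> * (d k)\<^sup>2" by (simp add: r_def)
    moreover have "(1 + \<kappa> / a) * r k = r k + \<kappa> * (r k / a)" by (simp add: algebra_simps)
    ultimately show ?thesis
      using nonneg[of k] by linarith
  qed
  show ?thesis
  \<comment> \<open>A vanishing gap stays zero, so by descent the iterates become constant, equal to
    \<open>xs\<close> by the subsequence, and all claims follow. Otherwise the gap is always
    positive, as the locale requires.\<close>
  proof (cases "\<exists>K. r K = 0")
    case True
    then obtain K where K: "r K = 0" by blast
    have r0: "r k = 0" if "K \<le> k" for k
      using antimonoD[OF anti that] nonneg[of k] K by simp
    have "d k = 0" if "K \<le> k" for k
      using descent[of k] r0[of k] r0[of "Suc k"] that \<open>0 < a\<close>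
      by (simp add: mult_le_0_iff)
    then have step: "x (Suc k) = x k" if "K \<le> k" for k
      using that by (fastforce simp: d_def)
    have const: "x k = x K" if "K \<le> k" for k
      using that by (induction k rule: dec_induct) (auto simp: step)
    have "x (\<rho> j) = x K" if "K \<le> j" for j
      using const[of "\<rho> j"] seq_suble[OF \<rho>(1), of j] that by simp
    then have "\<forall>\<^sub>F j in sequentially. x (\<rho> j) = x K"
      unfolding eventually_sequentially by blast
    from LIMSEQ_unique[OF tendsto_eventually[OF this] x\<rho>] have "x K = xs" .
    with const have xk: "\<And>k. K \<le> k \<Longrightarrow> x k = xs" by simp
    then have hk: "\<And>k. K \<le> k \<Longrightarrow> hr k = hs" using hr hs by (metis ereal.inject)
    have "\<forall>\<^sub>F k in sequentially. \<bar>hr k - hs\<bar> \<le> 0 * (1 / 2) ^ k"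
      and "\<forall>\<^sub>F k in sequentially. norm (x k - xs) \<le> 0 * (1 / 2) ^ k"
      unfolding eventually_sequentially by (intro exI[of _ K]; simp add: xk hk)+
    then have "linear_rate (\<lambda>k. ereal \<bar>hr k - hs\<bar>)" "linear_rate (\<lambda>k. ereal (norm (x k - xs)))"
      by (auto intro: linear_rate_of_eventually_le[of "1 / 2" _ 0])
    \<comment> \<open>Errors that are eventually zero are of the order of any function
      \<open>F\<close>.\<close>
    moreover have ev1: "\<forall>\<^sub>F k in sequentially. norm (hr k - hs) \<le> 0 * norm (F k)"
      and ev2: "\<forall>\<^sub>F k in sequentially. norm (norm (x k - xs)) \<le> 0 * norm (F k)"
      for F :: "nat \<Rightarrow> real"
      unfolding eventually_sequentially by (intro exI[of _ K]; simp add: xk hk)+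
    have "(\<lambda>k. hr k - hs) \<in> O(F)" "(\<lambda>k. norm (x k - xs)) \<in> O(F)" for F :: "nat \<Rightarrow> real"
      by (rule bigoI[OF ev1], rule bigoI[OF ev2])
    ultimately show ?thesis using xk by (auto simp: hdiff)
  next
    case False
    with nonneg have pos: "\<And>k. 0 < r k" by (metis order_le_less)
    obtain c \<eta> V where c: "0 < c" and \<eta>: "0 < \<eta>" and V: "open V" "(xs, xs) \<in> V"
      and KL: "\<And>y v s. \<lbrakk>y \<in> V; ?H y = ?H (xs, xs) + ereal s; 0 < s; s < \<eta>;
        v \<in> limiting_subdiff ?H y\<rbrakk> \<Longrightarrow> s powr (1 - \<theta>) \<le> c * norm v"
      using KL_exponent_neighborhood[OF assms(10)] by metis
    obtain \<epsilon> where \<epsilon>: "0 < \<epsilon>"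
      and ball: "\<And>y z. \<lbrakk>norm (y - xs) < \<epsilon>; norm (z - xs) < \<epsilon>\<rbrakk> \<Longrightarrow> (y, z) \<in> V"
      using open_contains_product_ball[OF V] by metis
    \<comment> \<open>The constant combines \<open>c\<close> from the KL inequality with
      \<open>b / 2\<close> from the subgradient bound in \<open>cond_H2\<close>.\<close>
    interpret KL_descent x xs r a "c * (b / 2)" \<theta> \<epsilon> \<eta> d
    proof unfold_locales
      fix k
      assume near: "norm (x k - xs) < \<epsilon>" "norm (x (Suc k) - xs) < \<epsilon>" "r (Suc k) < \<eta>"
      obtain w where w: "w \<in> limiting_subdiff ?H (zseq x (Suc k))"
        "norm w \<le> b / 2 * (d k + d (Suc k))"
        using assms(8) unfolding cond_H2_def d_def diff_Suc_1 by blast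
      have "zseq x (Suc k) \<in> V" using ball near by (simp add: zseq_def)
      then have "r (Suc k) powr (1 - \<theta>) \<le> c * norm w"
        using KL[of "zseq x (Suc k)" "r (Suc k)" w] w(1) pos near(3) by (simp add: Hr Hs)
      also have "\<dots> \<le> c * (b / 2 * (d k + d (Suc k)))"
        using w(2) c by (intro mult_left_mono) auto
      finally show "r (Suc k) powr (1 - \<theta>) \<le> c * (b / 2) * (d k + d (Suc k))" by simp
    qed (use \<rho>(1) x\<rho> c \<open>0 < a\<close> \<open>0 < b\<close> \<theta> \<epsilon> \<eta> pos lim descent d_def in auto)
    have "linear_rate (\<lambda>k. ereal \<bar>hr k - hs\<bar>) \<and> linear_rate (\<lambda>k. ereal (norm (x k - xs)))"
      if half: "1 / 2 \<le> \<theta>"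
    proof -
      obtain C q where q: "0 < q" "q < 1"
        and ev: "\<forall>\<^sub>F k in sequentially. r k \<le> C * q ^ k \<and> norm (x k - xs) \<le> C * q ^ k"
        using linear_case[OF half] by blast
      have "\<forall>\<^sub>F k in sequentially. \<bar>hr k - hs\<bar> \<le> ((1 + \<kappa> / a) * C) * q ^ k"
        using ev
      proof eventually_elim
        case (elim k)
        then have "(1 + \<kappa> / a) * r k \<le> (1 + \<kappa> / a) * (C * q ^ k)"
          using \<open>0 < a\<close> \<open>0 < \<kappa>\<close> by (intro mult_left_mono) auto
        then show ?case using err[of k] by (simp add: mult.assoc)
      qed
      moreover have "\<forall>\<^sub>F k in sequentially. norm (x k - xs) \<le> C * q ^ k"
        using ev by eventually_elim simp
      ultimately show ?thesis
        using linear_rate_of_eventually_le[OF q] by auto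
    qed
    moreover have "(\<lambda>k. hr k - hs) \<in> O(\<lambda>k. real k powr (1 / (2 * \<theta> - 1)))" if "\<theta> < 1 / 2"
    proof -
      have "(\<lambda>k. hr k - hs) \<in> O(r)"
        using err nonneg by (intro bigoI[of _ "1 + \<kappa> / a"]) auto
      then show ?thesis using sublinear_case(1)[OF that] by (rule landau_o.big_trans)
    qed
    \<comment> \<open>Here \<open>exponent_neq_1\<close> rules out \<open>\<theta> = 1\<close>, so
      finite termination at that exponent comes entirely from the case of a vanishing gap.\<close>
    ultimately show ?thesis
      using exponent_neq_1 sublinear_case(2) by (auto simp: hdiff)
  qed
qed

end
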